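(* Let $A\in\mathbb{R}^{m\times n}$ ($m,n\ge 1$) have no zero rows, let $r=\mathrm{rank}(A)$, and let $A=U\Sigma V^\top$ be a compact singular value decomposition. Let $\hat A$ and $L$ be as defined in the context and let $M=I_r-(\hat AV)^\top L^{-1}\hat AV$. Then $$\|M\|_{\mathrm{op}}^2\le\frac{\|L-I_m\|_{\mathrm{op}}^2}{\|L-I_m\|_{\mathrm{op}}^2+\sigma_r^2(\hat A)}\le\frac{\max_{1\le i\le m}\|a_i\|^2\,\|L-I_m\|_{\mathrm{op}}^2}{\max_{1\le i\le m}\|a_i\|^2\,\|L-I_m\|_{\mathrm{op}}^2+\sigma_r^2(A)}.$$
   Context: $\|\cdot\|$ is the Euclidean norm on vectors and $\|\cdot\|_{\mathrm{op}}$ the induced operator (spectral) norm on matrices; $I_p$ is the $p\times p$ identity. The rows of $A$ are $a_1,\dots,a_m\in\mathbb{R}^n$ (viewed as column vectors), $\hat a_i=a_i/\|a_i\|$, and $\hat A\in\mathbb{R}^{m\times n}$ is the matrix with rows $\hat a_i$ (it also has rank $r$). For a matrix $B$ of rank $r$, $\sigma_1(B)\ge\dots\ge\sigma_r(B)>0$ denote its positive singular values. Compact SVD: $A=U\Sigma V^\top$ with $U\in\mathbb{R}^{m\times r}$, $V\in\mathbb{R}^{n\times r}$, $U^\top U=V^\top V=I_r$, $\Sigma=\mathrm{diag}(\sigma_1(A),\dots,\sigma_r(A))$. $L\in\mathbb{R}^{m\times m}$ is the unit lower triangular matrix with $L_{ij}=\langle\hat a_i,\hat a_j\rangle$ for $j<i$,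 $L_{ii}=1$, $L_{ij}=0$ for $j>i$. *)

theory Defs
  imports "HOL-Analysis.Analysis" "HOL-Library.Multiset"
begin

definition op_norm :: "real^'n^'m \<Rightarrow> real" where
  "op_norm B = onorm ((*v) B)"

definition gram_eigenspace :: "real^'n^'m \<Rightarrow> real \<Rightarrow> (real^'n) set" where
  "gram_eigenspace B s = {v. (transpose B ** B) *v v = s\<^sup>2 *\<^sub>R v}"

text \<open>Singular values are the square roots of the eigenvalues of $B^T B$, each repeated as often
  as the dimension of the eigenspace.\<close>

definition positive_singular_values :: "real^'n^'m \<Rightarrow> real set" where
  "positive_singular_values B = {s. 0 < s \<and> (\<exists>v \<in> gram_eigenspace B s. v \<noteq> 0)}"

text \<open>The multiset below is a sum over a set, so this set has to be finite.\<close>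

lemma finite_positive_singular_values: "finite (positive_singular_values B)"
proof -
  let ?P = "positive_singular_values B"
  have "\<forall>s \<in> ?P. \<exists>v. v \<in> gram_eigenspace B s \<and> v \<noteq> 0"
    unfolding positive_singular_values_def by blast
  from bchoice[OF this] obtain f
    where f: "\<forall>s \<in> ?P. f s \<in> gram_eigenspace B s \<and> f s \<noteq> 0" ..
  have orth: "f s \<bullet> f t = 0" if "s \<in> ?P" "t \<in> ?P" "s \<noteq> t" for s t
  proof -
    have ev: "(transpose B ** B) *v f s = s\<^sup>2 *\<^sub>R f s" "(transpose B ** B) *v f t = t\<^sup>2 *\<^sub>R f t"
      using f that unfolding gram_eigenspace_def by blast+
    have "transpose (transpose B ** B) = transpose B ** B"
      by (simp add: matrix_transpose_mul)
    then have "((transpose B ** B) *v x) \<bullet> y = x \<bullet> ((transpose B ** B) *v y)" for x y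
      using dot_lmul_matrix[of x "transpose B ** B" y]
        transpose_matrix_vector[of "transpose B ** B" x] by simp
    from this[of "f s" "f t"] have "s\<^sup>2 * (f s \<bullet> f t) = t\<^sup>2 * (f s \<bullet> f t)"
      unfolding ev by simp
    moreover have "s\<^sup>2 \<noteq> t\<^sup>2"
      using that by (auto simp: positive_singular_values_def power2_eq_iff)
    ultimately show ?thesis by simp
  qed
  have inj: "inj_on f ?P"
  proof (rule inj_onI, rule ccontr)
    fix s t assume st: "s \<in> ?P" "t \<in> ?P" "f s = f t" "s \<noteq> t"
    have "f s = 0" using orth[OF st(1,2,4)] unfolding st(3)[symmetric] by simp
    with f st(1) show False by blast
  qed
  have po: "pairwise orthogonal (f ` ?P)"
    unfolding pairwise_def orthogonal_def using orth by blast
  have nz: "0 \<notin> f ` ?P"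
  proof
    assume "0 \<in> f ` ?P"
    then obtain s where s: "0 = f s" "s \<in> ?P" by (rule imageE)
    with f show False by metis
  qed
  have "finite (f ` ?P)"
    using pairwise_orthogonal_independent[OF po nz] by (rule independent_imp_finite)
  then show ?thesis
    using inj by (rule finite_imageD)
qed

definition positive_singular_mset :: "real^'n^'m \<Rightarrow> real multiset" where
  "positive_singular_mset B =
     (\<Sum>s \<in> positive_singular_values B. replicate_mset (dim (gram_eigenspace B s)) s)"

text \<open>The index \<open>k\<close> starts at 1; only \<open>1 \<le> k \<le> rank B\<close> is meaningful.\<close>

definition singular_value :: "real^'n^'m \<Rightarrow> nat \<Rightarrow> real" where
  "singular_value B k = rev (sorted_list_of_multiset (positive_singular_mset B)) ! (k - 1)"

text \<open>A finite linearly ordered index type plays the role of $\{1,\dots,r\}$: the position of \<open>i\<close>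
  in it is \<open>card {..i}\<close>.\<close>

definition singular_value_diag ::
    "real^'n^'m \<Rightarrow> real^('r::{finite,linorder})^('r::{finite,linorder})" where
  "singular_value_diag A = (\<chi> i j. if i = j then singular_value A (card {..i}) else 0)"

definition compact_svd ::
    "real^'n^'m \<Rightarrow> real^('r::{finite,linorder})^'m \<Rightarrow>
      real^('r::{finite,linorder})^('r::{finite,linorder}) \<Rightarrow>
      real^('r::{finite,linorder})^'n \<Rightarrow> bool" where
  "compact_svd A U S V \<longleftrightarrow>
     CARD('r) = rank A \<and>
     transpose U ** U = mat 1 \<and> transpose V ** V = mat 1 \<and>
     S = singular_value_diag A \<and>
     A = U ** S ** transpose V"

definition normalize_rows :: "real^'n^'m \<Rightarrow> real^'n^'m" where
  "normalize_rows A = (\<chi> i. (1 / norm (row i A)) *\<^sub>R row i A)"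

definition lower_gram ::
    "real^'n^('m::{finite,linorder}) \<Rightarrow> real^('m::{finite,linorder})^('m::{finite,linorder})" where
  "lower_gram A = (\<chi> i j.
     if j < i then row i (normalize_rows A) \<bullet> row j (normalize_rows A)
     else if j = i then 1 else 0)"

end

theory Submission
  imports Defs
begin

text \<open>Put B = Ah V. Each off-diagonal entry of the Gram matrix Ah Ah^T occurs in exactly one
  of L and L^T, and the rows of Ah have norm 1, so L + L^T = Ah Ah^T + I
  (\<open>lower_gram_add_transpose\<close>). As V V^T fixes the row space of A, which is also that
  of Ah, Ah Ah^T = B B^T (\<open>compact_svd_span_rows\<close>). For y = L^-1 B x the identity L +
  L^T = B B^T + I gives |M x|^2 = |x|^2 - |y|^2 and B M x = (I - L^T) y. Since V is an isometry onto
  the row space, |B z| >= sigma_r(Ah) |z|, hence sigma_r(Ah) |M x| <= |L - I| |y|; eliminating |y|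
  yields the first inequality (\<open>iteration_matrix_bound\<close>).

  The second inequality follows from sigma_r(A)^2 <= max |a_i|^2 sigma_r(Ah)^2, which holds because
  A is Ah with its rows rescaled by |a_i| (\<open>singular_value_rank_le_normalize_rows\<close>).

  What remains is spectral theory. Singular values are defined through eigenspaces of the Gram
  matrix, so it must be shown that they number exactly the rank
  (\<open>size_positive_singular_mset\<close>) and that the last one bounds the stretching of the
  row space from below (\<open>singular_value_rank_le\<close>). Both rest on minimising a Rayleigh
  quotient (\<open>gram_min_eigenvector\<close>).\<close>

section \<open>Row space and eigenspaces of the Gram matrix\<close>

lemma vector_matrix_mult_in_span_rows:
  fixes B :: "real^'n^'m"
  shows "y v* B \<in> span (rows B)"
proof -
  have "y v* B = (\<Sum>i\<in>UNIV. y $ i *\<^sub>R row i B)"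
    by (simp add: vec_eq_iff vector_matrix_mult_def row_def mult.commute)
  also have "\<dots> \<in> span (rows B)"
    by (intro span_sum span_mul span_base) (auto simp: rows_def)
  finally show ?thesis .
qed

lemma matrix_vector_mult_eq_0_on_span_rows:
  fixes B :: "real^'n^'m"
  assumes "v \<in> span (rows B)" and "B *v v = 0"
  shows "v = 0"
proof -
  have "orthogonal v w" if "w \<in> rows B" for w
  proof -
    from that obtain i where "w = row i B"
      by (auto simp: rows_def)
    moreover have "(B *v v) $ i = B $ i \<bullet> v"
      by (rule matrix_vector_mul_component)
    ultimately show ?thesis
      using assms(2) by (simp add: orthogonal_def row_def inner_commute)
  qed
  then have "orthogonal v v"
    by (rule orthogonal_to_span[OF assms(1)])
  then show ?thesis
    by (simp add: orthogonal_self)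
qed

text \<open>Writing B^T (B v) with \<open>v*\<close> lets \<open>dot_lmul_matrix\<close> move B
  across inner products.\<close>

lemma mem_gram_eigenspace_iff:
  "v \<in> gram_eigenspace B s \<longleftrightarrow> (B *v v) v* B = s\<^sup>2 *\<^sub>R v"
  by (simp add: gram_eigenspace_def flip: matrix_vector_mul_assoc)

lemma subspace_gram_eigenspace: "subspace (gram_eigenspace B s)"
  by (auto simp: subspace_def gram_eigenspace_def matrix_vector_right_distrib
      matrix_vector_mult_scaleR scaleR_add_right)

lemma gram_eigenspace_subset_span_rows:
  assumes "s \<noteq> 0"
  shows "gram_eigenspace B s \<subseteq> span (rows B)"
proof
  fix v assume "v \<in> gram_eigenspace B s"
  then have "v = (1 / s\<^sup>2) *\<^sub>R ((B *v v) v* B)"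
    using assms by (simp add: mem_gram_eigenspace_iff)
  then show "v \<in> span (rows B)"
    by (metis span_mul vector_matrix_mult_in_span_rows)
qed

text \<open>Both s^2 (v . w) and t^2 (v . w) equal (B v) . (B w).\<close>

lemma gram_eigenspaces_orthogonal:
  assumes "v \<in> gram_eigenspace B s" "w \<in> gram_eigenspace B t" "s\<^sup>2 \<noteq> t\<^sup>2"
  shows "v \<bullet> w = 0"
proof -
  have "s\<^sup>2 * (v \<bullet> w) = ((B *v v) v* B) \<bullet> w"
    using assms(1) by (simp add: mem_gram_eigenspace_iff)
  also have "\<dots> = (B *v w) \<bullet> (B *v v)"
    unfolding dot_lmul_matrix by (rule inner_commute)
  also have "\<dots> = ((B *v w) v* B) \<bullet> v"
    by (simp only: dot_lmul_matrix)
  also have "\<dots> = t\<^sup>2 * (v \<bullet> w)"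
    using assms(2) by (simp add: mem_gram_eigenspace_iff inner_commute)
  finally show ?thesis
    using assms(3) by simp
qed

section \<open>Minimising the Rayleigh quotient\<close>

text \<open>The polynomial has its minimum at t = 0, so its derivative 2 b there vanishes. This is
  the first-variation argument for the minimiser below.\<close>

lemma linear_term_zero_if_quadratic_nonneg:
  fixes b c :: real
  assumes "\<And>t. 0 \<le> 2 * t * b + t\<^sup>2 * c"
  shows "b = 0"
proof (rule ccontr)
  assume "b \<noteq> 0"
  have c: "c \<ge> 0"
    using assms[of 1] assms[of "-1"] by simp
  \<comment> \<open>Dividing by c + 1 instead of c covers c = 0; the polynomial then takes the value
    t b - t^2 < 0.\<close>
  define t where "t = - b / (c + 1)"
  have tc: "t * (c + 1) = - b"
    using c by (simp add: t_def)
  have "2 * t * b + t\<^sup>2 * c = 2 * t * b + t * (t * (c + 1)) - t\<^sup>2"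
    by (simp add: power2_eq_square algebra_simps)
  also have "\<dots> = t * b - t\<^sup>2"
    unfolding tc by simp
  also have "t * b = - (b\<^sup>2 / (c + 1))"
    by (simp add: t_def power2_eq_square)
  also have "- (b\<^sup>2 / (c + 1)) - t\<^sup>2 < 0"
    using \<open>b \<noteq> 0\<close> c by (smt (verit) divide_pos_pos zero_less_power2 zero_le_power2)
  finally show False
    using assms[of t] by simp
qed

text \<open>A minimiser of the Rayleigh quotient on an invariant subspace is an eigenvector.\<close>

lemma gram_min_eigenvector:
  fixes B :: "real^'n^'m"
  assumes W: "subspace W" and W0: "W \<noteq> {0}" and WR: "W \<subseteq> span (rows B)"
    and inv: "\<And>v. v \<in> W \<Longrightarrow> (B *v v) v* B \<in> W"
  obtains s w where "0 < s" "w \<in> W" "w \<noteq> 0" "w \<in> gram_eigenspace B s"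
    "\<And>v. v \<in> W \<Longrightarrow> s * norm v \<le> norm (B *v v)"
proof -
  have "compact (W \<inter> sphere 0 1)"
    using closed_subspace[OF W] by (intro closed_Int_compact) auto
  moreover have "W \<inter> sphere 0 1 \<noteq> {}"
  proof -
    obtain x where "x \<in> W" "x \<noteq> 0"
      using W0 subspace_0[OF W] by blast
    then have "(1 / norm x) *\<^sub>R x \<in> W \<inter> sphere 0 1"
      using W by (simp add: subspace_scale)
    then show ?thesis by blast
  qed
  moreover have "continuous_on (W \<inter> sphere 0 1) (\<lambda>v. norm (B *v v))"
    by (intro continuous_intros linear_continuous_on matrix_vector_mul_bounded_linear)
  ultimately have "\<exists>w \<in> W \<inter> sphere 0 1. \<forall>v \<in> W \<inter> sphere 0 1. norm (B *v w) \<le> norm (B *v v)"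
    by (rule continuous_attains_inf)
  then obtain w where w: "w \<in> W" "norm w = 1"
    and min: "\<And>v. v \<in> W \<Longrightarrow> norm v = 1 \<Longrightarrow> norm (B *v w) \<le> norm (B *v v)"
    by (auto simp: dist_norm)
  define s where "s = norm (B *v w)"
  have lower: "s * norm v \<le> norm (B *v v)" if "v \<in> W" for v
  proof (cases "v = 0")
    case False
    have "s \<le> norm (B *v ((1 / norm v) *\<^sub>R v))"
      unfolding s_def using False that W by (intro min) (auto simp: subspace_scale)
    then show ?thesis
      using False by (simp add: matrix_vector_mult_scaleR field_simps)
  qed simp
  have "w \<noteq> 0"
    using w(2) by auto
  \<comment> \<open>The kernel of B meets the row space only in 0.\<close>
  then have "0 < s"
    unfolding s_def using matrix_vector_mult_eq_0_on_span_rows w(1) WR by auto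
  \<comment> \<open>The residual of the eigenvector equation at w. It is shown orthogonal to all of
    W by perturbing w along W; invariance puts it in W, so it is 0.\<close>
  define g where "g = (B *v w) v* B - s\<^sup>2 *\<^sub>R w"
  have gW: "g \<in> W"
    unfolding g_def using W w(1) by (intro subspace_diff subspace_scale inv)
  have gv: "g \<bullet> v = 0" if "v \<in> W" for v
  proof (rule linear_term_zero_if_quadratic_nonneg)
    fix t :: real
    have "w + t *\<^sub>R v \<in> W"
      using W w(1) that by (intro subspace_add subspace_scale)
    then have "(s * norm (w + t *\<^sub>R v))\<^sup>2 \<le> (norm (B *v (w + t *\<^sub>R v)))\<^sup>2"
      using lower \<open>0 < s\<close> by (intro power_mono) auto
    then have "s\<^sup>2 * ((w + t *\<^sub>R v) \<bullet> (w + t *\<^sub>R v)) \<le> (B *v (w + t *\<^sub>R v)) \<bullet> (B *v (w + t *\<^sub>R v))"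
      by (simp add: power_mult_distrib power2_norm_eq_inner)
    moreover have "(B *v v) \<bullet> (B *v w) = g \<bullet> v + s\<^sup>2 * (v \<bullet> w)"
      by (simp add: g_def inner_diff_left dot_lmul_matrix inner_commute[of v w] inner_commute[of "B *v v"])
    moreover have "w \<bullet> w = 1" and "(B *v w) \<bullet> (B *v w) = s\<^sup>2"
      using w(2) by (simp_all add: s_def flip: power2_norm_eq_inner)
    ultimately show "0 \<le> 2 * t * (g \<bullet> v) + t\<^sup>2 * ((B *v v) \<bullet> (B *v v) - s\<^sup>2 * (v \<bullet> v))"
      by (simp add: matrix_vector_right_distrib matrix_vector_mult_scaleR inner_add_left
          inner_add_right inner_commute power2_eq_square algebra_simps)
  qed
  have "g = 0"
    using gv[OF gW] by simp
  then have "w \<in> gram_eigenspace B s"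
    by (simp add: mem_gram_eigenspace_iff g_def)
  with that \<open>0 < s\<close> w(1) \<open>w \<noteq> 0\<close> lower show ?thesis
    by blast
qed

section \<open>Counting and ordering the singular values\<close>

text \<open>Orthogonal bases of the eigenspaces for positive s unite to a basis E of the row space,
  whose dimension is the rank. If E did not span, its orthogonal complement within the row space
  would be a nonzero invariant subspace and so contain a further eigenvector, which already lies in
  the span of E.\<close>

lemma size_positive_singular_mset: "size (positive_singular_mset B) = rank B"
proof -
  let ?P = "positive_singular_values B" and ?R = "span (rows B)"
  have "\<forall>s. \<exists>C. 0 \<notin> C \<and> C \<subseteq> gram_eigenspace B s \<and> pairwise orthogonal C \<and> independent C
      \<and> card C = dim (gram_eigenspace B s) \<and> span C = gram_eigenspace B s"
    by (metis orthogonal_basis_subspace subspace_gram_eigenspace)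
  then obtain C where C: "\<And>s. 0 \<notin> C s" "\<And>s. C s \<subseteq> gram_eigenspace B s"
    "\<And>s. pairwise orthogonal (C s)" "\<And>s. independent (C s)"
    "\<And>s. card (C s) = dim (gram_eigenspace B s)" "\<And>s. span (C s) = gram_eigenspace B s"
    by metis
  define E where "E = (\<Union>s\<in>?P. C s)"
  have sq: "s\<^sup>2 \<noteq> t\<^sup>2" if "s \<in> ?P" "t \<in> ?P" "s \<noteq> t" for s t
    using that by (auto simp: positive_singular_values_def power2_eq_iff)
  have orth: "v \<bullet> w = 0" if "s \<in> ?P" "t \<in> ?P" "s \<noteq> t" "v \<in> C s" "w \<in> C t" for s t v w
    using gram_eigenspaces_orthogonal[of v B s w t] sq that C(2) by blast
  have "pairwise orthogonal E"
    unfolding pairwise_def orthogonal_def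
  proof (intro ballI impI)
    fix v w assume "v \<in> E" "w \<in> E" "v \<noteq> w"
    then obtain s t where st: "s \<in> ?P" "t \<in> ?P" "v \<in> C s" "w \<in> C t"
      unfolding E_def by blast
    show "v \<bullet> w = 0"
    proof (cases "s = t")
      case True
      with C(3)[of s] st \<open>v \<noteq> w\<close> show ?thesis
        by (simp add: pairwise_def orthogonal_def)
    next
      case False
      with orth st show ?thesis by blast
    qed
  qed
  moreover have "0 \<notin> E"
    using C(1) by (auto simp: E_def)
  ultimately have indep: "independent E"
    by (rule pairwise_orthogonal_independent)
  have ER: "E \<subseteq> ?R"
    unfolding E_def
  proof (rule UN_least)
    fix s assume "s \<in> ?P"
    then have "s \<noteq> 0"
      by (simp add: positive_singular_values_def)
    then show "C s \<subseteq> ?R"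
      using C(2)[of s] gram_eigenspace_subset_span_rows[of s B] by blast
  qed
  have "?R \<subseteq> span E"
  proof (rule ccontr)
    assume "\<not> ?R \<subseteq> span E"
    then have "span E \<subset> ?R"
      using span_minimal[OF ER subspace_span] by blast
    then obtain x where x: "x \<noteq> 0" "x \<in> ?R" "\<And>y. y \<in> span E \<Longrightarrow> orthogonal x y"
      using orthogonal_to_subspace_exists_gen[of E "rows B"] by blast
    define W where "W = {v \<in> ?R. \<forall>e\<in>E. v \<bullet> e = 0}"
    have W: "subspace W"
      by (auto simp: W_def subspace_def inner_add_left span_add span_mul span_zero)
    have "x \<in> W"
      using x by (auto simp: W_def orthogonal_def span_base)
    with x(1) have "W \<noteq> {0}" by blast
    have inv: "(B *v v) v* B \<in> W" if "v \<in> W" for v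
      unfolding W_def
    proof (intro CollectI conjI ballI vector_matrix_mult_in_span_rows)
      fix e assume "e \<in> E"
      then obtain s where "e \<in> gram_eigenspace B s"
        using C(2) by (auto simp: E_def)
      then have "((B *v v) v* B) \<bullet> e = v \<bullet> (s\<^sup>2 *\<^sub>R e)"
        by (metis dot_lmul_matrix inner_commute mem_gram_eigenspace_iff)
      then show "((B *v v) v* B) \<bullet> e = 0"
        using that \<open>e \<in> E\<close> by (simp add: W_def)
    qed
    have "W \<subseteq> ?R"
      by (auto simp: W_def)
    then obtain s w where sw: "0 < s" "w \<in> W" "w \<noteq> 0" "w \<in> gram_eigenspace B s"
      using gram_min_eigenvector[OF W \<open>W \<noteq> {0}\<close> _ inv] by blast
    then have "s \<in> ?P"
      by (auto simp: positive_singular_values_def)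
    \<comment> \<open>As an eigenvector w lies in the span of \<open>C s\<close>, but as a member of
      W it is orthogonal to \<open>C s\<close>.\<close>
    then have "C s \<subseteq> E"
      by (auto simp: E_def)
    then have "orthogonal w y" if "y \<in> C s" for y
      using sw(2) that by (auto simp: W_def orthogonal_def)
    then have "orthogonal w w"
      using sw(4) C(6) by (metis orthogonal_to_span)
    with sw(3) show False
      by (simp add: orthogonal_self)
  qed
  then have "card E = rank B"
    using basis_card_eq_dim[OF ER _ indep] by (simp add: row_rank_def)
  moreover have "card E = (\<Sum>s\<in>?P. card (C s))"
    unfolding E_def
  proof (rule card_UN_disjoint)
    show "finite ?P" by (rule finite_positive_singular_values)
    show "\<forall>s\<in>?P. finite (C s)"
      using C(4) independent_imp_finite by blast
    show "\<forall>s\<in>?P. \<forall>t\<in>?P. s \<noteq> t \<longrightarrow> C s \<inter> C t = {}"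
    proof (intro ballI impI equals0I)
      fix s t v assume "s \<in> ?P" "t \<in> ?P" "s \<noteq> t" "v \<in> C s \<inter> C t"
      then have "v \<bullet> v = 0" using orth by blast
      with \<open>v \<in> C s \<inter> C t\<close> C(1)[of s] show False by auto
    qed
  qed
  ultimately show ?thesis
    by (simp add: positive_singular_mset_def size_multiset_sum C(5))
qed

lemma set_positive_singular_mset:
  "set_mset (positive_singular_mset B) = positive_singular_values B"
proof -
  have "dim (gram_eigenspace B s) \<noteq> 0" if "s \<in> positive_singular_values B" for s
    using that by (auto simp: positive_singular_values_def dim_eq_0)
  then show ?thesis
    by (auto simp: positive_singular_mset_def set_mset_sum finite_positive_singular_values
        split: if_splits)
qed

text \<open>The sorted list has exactly \<open>rank B\<close> entries, so position
  \<open>rank B\<close> of its reversal is the head of the ascending list. Nonzero rank keeps the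
  truncated \<open>k - 1\<close> from misreading the index.\<close>

lemma singular_value_rank_least:
  assumes "rank B \<noteq> 0"
  shows "singular_value B (rank B) \<in> positive_singular_values B"
    and "s \<in> positive_singular_values B \<Longrightarrow> singular_value B (rank B) \<le> s"
proof -
  let ?l = "sorted_list_of_multiset (positive_singular_mset B)"
  have len: "length ?l = rank B"
    by (metis mset_sorted_list_of_multiset size_mset size_positive_singular_mset)
  have sv: "singular_value B (rank B) = ?l ! 0"
    using assms by (simp add: singular_value_def rev_nth len)
  have set: "set ?l = positive_singular_values B"
    by (simp add: set_positive_singular_mset)
  show "singular_value B (rank B) \<in> positive_singular_values B"
    unfolding sv set[symmetric] using assms len by (intro nth_mem) simp
  show "singular_value B (rank B) \<le> s" if "s \<in> positive_singular_values B"
  proof -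
    have "s \<in> set ?l"
      unfolding set by (rule that)
    then obtain i where "i < length ?l" "s = ?l ! i"
      unfolding in_set_conv_nth by blast
    then show ?thesis
      unfolding sv by (simp add: sorted_nth_mono)
  qed
qed

text \<open>The minimal stretching factor on the row space is attained at an eigenvector, so it is
  itself a positive singular value and at least the smallest one.\<close>

lemma singular_value_rank_le:
  fixes B :: "real^'n^'m"
  assumes "rank B \<noteq> 0" and v: "v \<in> span (rows B)"
  shows "singular_value B (rank B) * norm v \<le> norm (B *v v)"
proof -
  have "span (rows B) \<noteq> {0}"
    using assms(1) by (metis dim_eq_0 dim_span order_refl row_rank_def)
  then obtain s w where sw: "0 < s" "w \<noteq> 0" "w \<in> gram_eigenspace B s"
    "s * norm v \<le> norm (B *v v)"
    using gram_min_eigenvector[of "span (rows B)" B] v vector_matrix_mult_in_span_rows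
      subspace_span order_refl by metis
  then have "singular_value B (rank B) \<le> s"
    using assms(1) by (intro singular_value_rank_least) (auto simp: positive_singular_values_def)
  then show ?thesis
    using sw(4) by (meson mult_right_mono norm_ge_zero order_trans)
qed

section \<open>Operator norm\<close>

lemma norm_le_op_norm: "norm (B *v x) \<le> op_norm B * norm x"
  unfolding op_norm_def by (intro onorm matrix_vector_mul_bounded_linear)

lemma op_norm_nonneg: "0 \<le> op_norm B"
  unfolding op_norm_def by (intro onorm_pos_le matrix_vector_mul_bounded_linear)

text \<open>The transpose has no larger operator norm: |B^T y|^2 = y . B B^T y, then Cauchy-Schwarz
  and cancellation of one factor |B^T y|.\<close>

lemma norm_vector_matrix_le_op_norm:
  fixes B :: "real^'n^'m"
  shows "norm (y v* B) \<le> op_norm B * norm y"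
proof (cases "y v* B = 0")
  case False
  have "norm (y v* B) * norm (y v* B) = (y v* B) \<bullet> (y v* B)"
    by (simp add: norm_eq_sqrt_inner)
  also have "\<dots> = y \<bullet> (B *v (y v* B))"
    by (rule dot_lmul_matrix)
  also have "\<dots> \<le> norm y * norm (B *v (y v* B))"
    by (rule norm_cauchy_schwarz)
  also have "\<dots> \<le> norm y * (op_norm B * norm (y v* B))"
    by (intro mult_left_mono norm_le_op_norm) simp
  finally show ?thesis
    using False by (simp add: mult.commute mult.left_commute)
qed (simp add: op_norm_nonneg)

section \<open>Normalised rows, the matrix L and the compact SVD\<close>

lemma row_normalize_rows: "row i (normalize_rows A) = (1 / norm (row i A)) *\<^sub>R row i A"
  by (simp add: normalize_rows_def row_def vec_eq_iff)

lemma span_rows_normalize_rows: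
  assumes "\<And>i. row i A \<noteq> 0"
  shows "span (rows (normalize_rows A)) = span (rows A)"
proof (rule span_eq[THEN iffD2], intro conjI subsetI)
  fix x assume "x \<in> rows (normalize_rows A)"
  then obtain i where "x = (1 / norm (row i A)) *\<^sub>R row i A"
    by (auto simp: rows_def row_normalize_rows)
  moreover have "row i A \<in> rows A"
    by (auto simp: rows_def)
  ultimately show "x \<in> span (rows A)"
    by (simp add: span_mul span_base)
next
  fix x assume "x \<in> rows A"
  then obtain i where "x = row i A"
    by (auto simp: rows_def)
  then have "x = norm (row i A) *\<^sub>R row i (normalize_rows A)"
    using assms by (simp add: row_normalize_rows)
  moreover have "row i (normalize_rows A) \<in> rows (normalize_rows A)"
    by (auto simp: rows_def)
  ultimately show "x \<in> span (rows (normalize_rows A))"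
    by (simp add: span_mul span_base)
qed

text \<open>On the diagonal both sides equal 2, because normalised nonzero rows have norm 1;
  elsewhere exactly one of the two triangular summands contributes.\<close>

lemma lower_gram_add_transpose:
  fixes A :: "real^'n^('m::{finite,linorder})"
  assumes "\<And>i. row i A \<noteq> 0"
  shows "lower_gram A + transpose (lower_gram A)
    = normalize_rows A ** transpose (normalize_rows A) + mat 1"
proof -
  let ?N = "normalize_rows A"
  have N: "(?N ** transpose ?N) $ i $ j = row i ?N \<bullet> row j ?N" for i j
    by (simp add: matrix_matrix_mult_def transpose_def row_def inner_vec_def)
  have "row i ?N \<bullet> row i ?N = 1" for i
    using assms by (simp add: row_normalize_rows dot_square_norm power2_eq_square)
  then show ?thesis
    unfolding vec_eq_iff vector_add_component N
    by (auto simp: lower_gram_def transpose_def mat_def inner_commute)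
qed

text \<open>From A^T = V (U S)^T the row space lies in the range of V. That range has dimension at
  most r = rank A, so the two coincide and V V^T is the identity on them.\<close>

lemma compact_svd_span_rows:
  fixes V :: "real^('r::{finite,linorder})^'n"
  assumes svd: "compact_svd A U S V"
  shows "v \<in> span (rows A) \<Longrightarrow> V *v (v v* V) = v"
    and "V *v z \<in> span (rows A)"
proof -
  have A: "A = U ** S ** transpose V" and VV: "transpose V ** V = mat 1"
    and card: "CARD('r) = rank A"
    using svd unfolding compact_svd_def by blast+
  have lV: "linear ((*v) V)"
    by (rule matrix_vector_mul_linear)
  have id: "(V *v z) v* V = z" for z
    by (metis VV matrix_vector_mul_assoc matrix_vector_mul_lid transpose_matrix_vector)
  have sub: "subspace (range ((*v) V))"
    by (intro linear_subspace_image lV subspace_UNIV)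
  have "rows A \<subseteq> range ((*v) V)"
  proof
    fix x assume "x \<in> rows A"
    then obtain i where "x = row i A"
      by (auto simp: rows_def)
    then have "x = transpose A *v axis i 1"
      by (metis column_transpose matrix_vector_mult_basis)
    also have "transpose A = V ** transpose (U ** S)"
      by (metis A matrix_transpose_mul transpose_transpose)
    finally show "x \<in> range ((*v) V)"
      by (metis matrix_vector_mul_assoc rangeI)
  qed
  then have "span (rows A) \<subseteq> range ((*v) V)"
    using sub by (rule span_minimal)
  moreover have "dim (range ((*v) V)) \<le> dim (span (rows A))"
    using dim_image_le[OF lV, of UNIV] card by (simp add: row_rank_def)
  ultimately have eq: "span (rows A) = range ((*v) V)"
    using subspace_dim_equal[OF subspace_span sub] by blast
  show "v \<in> span (rows A) \<Longrightarrow> V *v (v v* V) = v"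
    unfolding eq using id by auto
  show "V *v z \<in> span (rows A)"
    unfolding eq by simp
qed

section \<open>The bound for the iteration matrix\<close>

text \<open>With \<open>y = L\<^sup>-\<^sup>1 B x\<close>, the relation \<open>L + L\<^sup>T = B B\<^sup>T + I\<close> yields both
  \<open>\<parallel>M x\<parallel>\<^sup>2 = \<parallel>x\<parallel>\<^sup>2 - \<parallel>y\<parallel>\<^sup>2\<close> and \<open>B M x = (I - L\<^sup>T) y\<close>;
  the bound follows from \<open>\<sigma> \<parallel>M x\<parallel> \<le> \<parallel>B M x\<parallel> \<le> \<parallel>L - I\<parallel> \<parallel>y\<parallel>\<close>.\<close>

lemma iteration_matrix_bound:
  fixes B :: "real^'r^'m" and L :: "real^'m^'m"
  assumes sum: "L + transpose L = B ** transpose B + mat 1"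
    and lower: "\<And>z. \<sigma> * norm z \<le> norm (B *v z)" and "0 < \<sigma>"
  shows "(op_norm (mat 1 - transpose B ** matrix_inv L ** B))\<^sup>2
    \<le> (op_norm (L - mat 1))\<^sup>2 / ((op_norm (L - mat 1))\<^sup>2 + \<sigma>\<^sup>2)"
proof -
  let ?M = "mat 1 - transpose B ** matrix_inv L ** B" and ?d = "op_norm (L - mat 1)"
  have sum': "L *v y + y v* L = B *v (y v* B) + y" for y
    using arg_cong[OF sum, of "\<lambda>X. X *v y"]
    by (simp add: matrix_vector_mult_add_rdistrib flip: matrix_vector_mul_assoc)
  have quad: "2 * (y \<bullet> (L *v y)) = (norm (y v* B))\<^sup>2 + (norm y)\<^sup>2" for y
    using arg_cong[OF sum'[of y], of "(\<bullet>) y"]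
    by (simp add: inner_add_right power2_norm_eq_inner dot_lmul_matrix[symmetric] inner_commute)
  \<comment> \<open>By \<open>quad\<close>, 2 (y . L y) >= |y|^2, so L has trivial kernel.\<close>
  have "y = 0" if "L *v y = 0" for y
    using quad[of y] that by (simp add: sum_power2_eq_zero_iff)
  then have "invertible L"
    using matrix_left_invertible_ker invertible_left_inverse by blast
  then have inv: "L ** matrix_inv L = mat 1"
    unfolding invertible_def matrix_inv_def by (rule someI_ex[THEN conjunct1])
  have pointwise: "(norm (?M *v x))\<^sup>2 * (?d\<^sup>2 + \<sigma>\<^sup>2) \<le> ?d\<^sup>2 * (norm x)\<^sup>2" for x
  proof -
    define y where "y = matrix_inv L *v (B *v x)"
    have Ly: "L *v y = B *v x"
      unfolding y_def by (metis inv matrix_vector_mul_assoc matrix_vector_mul_lid)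
    have Mx: "?M *v x = x - y v* B"
      by (simp add: y_def matrix_vector_mult_diff_rdistrib flip: matrix_vector_mul_assoc)
    have "(norm (?M *v x))\<^sup>2 = (norm x)\<^sup>2 - 2 * (y \<bullet> (B *v x)) + (norm (y v* B))\<^sup>2"
      unfolding Mx by (simp add: power2_norm_eq_inner inner_diff inner_commute dot_lmul_matrix
          flip: dot_lmul_matrix[of y B x])
    then have Mx_norm: "(norm (?M *v x))\<^sup>2 = (norm x)\<^sup>2 - (norm y)\<^sup>2"
      using quad[of y] by (simp add: Ly)
    \<comment> \<open>B M x = L y - B B^T y, and \<open>sum'\<close> turns B B^T y into L y + L^T y
      - y.\<close>
    have "B *v (?M *v x) = - (y v* (L - mat 1))"
      using sum'[of y] unfolding Mx
      by (simp add: Ly matrix_vector_mult_diff_distrib vector_matrix_mult_diff_rdistrib algebra_simps)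
    then have "norm (B *v (?M *v x)) \<le> ?d * norm y"
      by (simp add: norm_vector_matrix_le_op_norm)
    then have "\<sigma> * norm (?M *v x) \<le> ?d * norm y"
      using lower order_trans by blast
    then have "(\<sigma> * norm (?M *v x))\<^sup>2 \<le> (?d * norm y)\<^sup>2"
      using \<open>0 < \<sigma>\<close> by (intro power_mono) auto
    \<comment> \<open>Substituting for |y|^2 leaves an inequality in |M x| and |x| alone.\<close>
    moreover have "(norm y)\<^sup>2 = (norm x)\<^sup>2 - (norm (?M *v x))\<^sup>2"
      using Mx_norm by simp
    ultimately have "\<sigma>\<^sup>2 * (norm (?M *v x))\<^sup>2 \<le> ?d\<^sup>2 * ((norm x)\<^sup>2 - (norm (?M *v x))\<^sup>2)"
      by (simp only: power_mult_distrib)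
    then show ?thesis
      by (simp add: algebra_simps)
  qed
  have pos: "0 < ?d\<^sup>2 + \<sigma>\<^sup>2"
    using \<open>0 < \<sigma>\<close> by (simp add: add_nonneg_pos)
  let ?b = "?d\<^sup>2 / (?d\<^sup>2 + \<sigma>\<^sup>2)"
  have "norm (?M *v x) \<le> sqrt ?b * norm x" for x
  proof (rule power2_le_imp_le)
    show "(norm (?M *v x))\<^sup>2 \<le> (sqrt ?b * norm x)\<^sup>2"
      using pointwise[of x] pos by (simp add: power_mult_distrib field_simps)
  qed simp
  then have "op_norm ?M \<le> sqrt ?b"
    unfolding op_norm_def by (rule onorm_le)
  then have "(op_norm ?M)\<^sup>2 \<le> (sqrt ?b)\<^sup>2"
    by (intro power_mono op_norm_nonneg)
  then show ?thesis
    by simp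
qed

section \<open>Comparing the smallest singular values of A and Ah\<close>

lemma norm_matrix_vector_le_normalize_rows:
  fixes A :: "real^'n^'m"
  assumes "\<And>i. row i A \<noteq> 0"
  shows "(norm (A *v v))\<^sup>2 \<le> (MAX i. (norm (row i A))\<^sup>2) * (norm (normalize_rows A *v v))\<^sup>2"
proof -
  have comp: "(C *v v) $ i = row i C \<bullet> v" for C :: "real^'n^'m" and i
    by (simp add: matrix_vector_mul_component row_def)
  have "((A *v v) $ i)\<^sup>2 = (norm (row i A))\<^sup>2 * ((normalize_rows A *v v) $ i)\<^sup>2" for i
    using assms[of i] by (simp add: comp row_normalize_rows power_divide)
  then show ?thesis
    by (auto simp: power2_norm_eq_inner inner_vec_def power2_eq_square[symmetric] sum_distrib_left
        intro!: sum_mono mult_right_mono Max_ge)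
qed

text \<open>Test with a right singular vector w of Ah for its smallest singular value s: with t that
  of A and K the largest squared row norm, t^2 |w|^2 <= |A w|^2 <= K |Ah w|^2 = K s^2 |w|^2.\<close>

lemma singular_value_rank_le_normalize_rows:
  fixes A :: "real^'n^'m"
  assumes "\<And>i. row i A \<noteq> 0" and "rank A \<noteq> 0"
  shows "(singular_value A (rank A))\<^sup>2
    \<le> (MAX i. (norm (row i A))\<^sup>2) * (singular_value (normalize_rows A) (rank A))\<^sup>2"
proof -
  let ?N = "normalize_rows A" and ?K = "MAX i. (norm (row i A))\<^sup>2"
  let ?s = "singular_value ?N (rank A)" and ?t = "singular_value A (rank A)"
  have span: "span (rows ?N) = span (rows A)"
    using assms(1) by (rule span_rows_normalize_rows)
  then have rank: "rank ?N = rank A"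
    by (metis dim_span row_rank_def)
  have "?s \<in> positive_singular_values ?N"
    using singular_value_rank_least(1)[of ?N] assms(2) by (simp add: rank)
  then obtain w where s: "0 < ?s" and w: "w \<in> gram_eigenspace ?N ?s" "w \<noteq> 0"
    by (auto simp: positive_singular_values_def)
  have "(norm (?N *v w))\<^sup>2 = ((?N *v w) v* ?N) \<bullet> w"
    by (simp add: power2_norm_eq_inner dot_lmul_matrix)
  then have Nw: "(norm (?N *v w))\<^sup>2 = ?s\<^sup>2 * (norm w)\<^sup>2"
    using w(1) by (simp add: mem_gram_eigenspace_iff power2_norm_eq_inner)
  have "w \<in> span (rows A)"
    using gram_eigenspace_subset_span_rows[of ?s ?N] s w(1) span by auto
  then have "?t * norm w \<le> norm (A *v w)"
    using singular_value_rank_le assms(2) by blast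
  moreover have "0 < ?t"
    using singular_value_rank_least(1)[OF assms(2)] by (simp add: positive_singular_values_def)
  ultimately have "(?t * norm w)\<^sup>2 \<le> (norm (A *v w))\<^sup>2"
    by (intro power_mono) auto
  also have "\<dots> \<le> ?K * (norm (?N *v w))\<^sup>2"
    using assms(1) by (rule norm_matrix_vector_le_normalize_rows)
  finally show ?thesis
    using w(2) by (simp add: Nw power_mult_distrib mult.assoc[symmetric])
qed

section \<open>Assembling the two inequalities\<close>

theorem lemma3:
  fixes A :: "real^'n^('m::{finite,linorder})"
    and U :: "real^('r::{finite,linorder})^('m::{finite,linorder})"
    and S :: "real^('r::{finite,linorder})^('r::{finite,linorder})"
    and V :: "real^('r::{finite,linorder})^'n"
    and Ah :: "real^'n^('m::{finite,linorder})"
    and L :: "real^('m::{finite,linorder})^('m::{finite,linorder})"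
    and M :: "real^('r::{finite,linorder})^('r::{finite,linorder})"
    and r :: nat
  assumes rows_nonzero: "\<And>i. row i A \<noteq> 0"
    and r: "r = rank A"
    and svd: "compact_svd A U S V"
    and Ah: "Ah = normalize_rows A"
    and L: "L = lower_gram A"
    and M: "M = mat 1 - transpose (Ah ** V) ** matrix_inv L ** (Ah ** V)"
  shows "(op_norm M)\<^sup>2
           \<le> (op_norm (L - mat 1))\<^sup>2 / ((op_norm (L - mat 1))\<^sup>2 + (singular_value Ah r)\<^sup>2)
       \<and> (op_norm (L - mat 1))\<^sup>2 / ((op_norm (L - mat 1))\<^sup>2 + (singular_value Ah r)\<^sup>2)
           \<le> ((MAX i. (norm (row i A))\<^sup>2) * (op_norm (L - mat 1))\<^sup>2)
             / ((MAX i. (norm (row i A))\<^sup>2) * (op_norm (L - mat 1))\<^sup>2 + (singular_value A r)\<^sup>2)"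
proof
  let ?K = "MAX i. (norm (row i A))\<^sup>2" and ?d = "op_norm (L - mat 1)"
  let ?s = "singular_value Ah r" and ?t = "singular_value A r"
  have span: "span (rows Ah) = span (rows A)"
    unfolding Ah using rows_nonzero by (rule span_rows_normalize_rows)
  then have rank: "rank Ah = r"
    unfolding r by (metis dim_span row_rank_def)
  \<comment> \<open>Index types are nonempty, so some row exists and is nonzero; hence r >= 1 and
    both r-th singular values are positive.\<close>
  have "A \<noteq> 0"
    using rows_nonzero by (auto simp: row_def vec_eq_iff)
  then have "rank A \<noteq> 0"
    by (simp add: rank_eq_0)
  then have s: "?s > 0" and t: "?t > 0"
    using singular_value_rank_least(1)[of Ah] singular_value_rank_least(1)[of A]
    by (simp_all add: rank r positive_singular_values_def)
  have VV: "transpose V ** V = mat 1"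
    using svd unfolding compact_svd_def by blast
  have isometry: "norm (V *v z) = norm z" for z
  proof -
    have "(V *v z) \<bullet> (V *v z) = ((V *v z) v* V) \<bullet> z"
      by (simp add: dot_lmul_matrix)
    also have "(V *v z) v* V = z"
      by (metis VV matrix_vector_mul_assoc matrix_vector_mul_lid transpose_matrix_vector)
    finally show ?thesis
      by (simp add: norm_eq)
  qed
  have lower: "?s * norm z \<le> norm ((Ah ** V) *v z)" for z
  proof -
    have "V *v z \<in> span (rows Ah)"
      unfolding span using svd by (rule compact_svd_span_rows)
    then show ?thesis
      using singular_value_rank_le[of Ah "V *v z"] \<open>rank A \<noteq> 0\<close>
      by (simp add: rank r isometry matrix_vector_mul_assoc)
  qed
  have "(Ah ** V) ** transpose (Ah ** V) = Ah ** transpose Ah"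
  proof -
    have "((Ah ** V) ** transpose (Ah ** V)) *v y = (Ah ** transpose Ah) *v y" for y
    proof -
      \<comment> \<open>Ah^T y lies in the common row space, where V V^T acts as the
        identity.\<close>
      have "V *v ((y v* Ah) v* V) = y v* Ah"
        using svd vector_matrix_mult_in_span_rows[of y Ah] unfolding span
        by (rule compact_svd_span_rows)
      then show ?thesis
        by (simp add: matrix_transpose_mul flip: matrix_vector_mul_assoc)
    qed
    then show ?thesis
      by (simp add: matrix_eq)
  qed
  then have "L + transpose L = (Ah ** V) ** transpose (Ah ** V) + mat 1"
    using lower_gram_add_transpose[OF rows_nonzero] by (simp add: L Ah)
  then show "(op_norm M)\<^sup>2 \<le> ?d\<^sup>2 / (?d\<^sup>2 + ?s\<^sup>2)"
    unfolding M using lower s by (rule iteration_matrix_bound)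
  have K: "0 < ?K"
  proof -
    \<comment> \<open>\<open>undefined\<close> serves as an arbitrary row index.\<close>
    have "0 < (norm (row undefined A))\<^sup>2"
      using rows_nonzero by simp
    also have "\<dots> \<le> ?K"
      by (rule Max_ge) auto
    finally show ?thesis .
  qed
  have "?t\<^sup>2 \<le> ?K * ?s\<^sup>2"
    using singular_value_rank_le_normalize_rows[OF rows_nonzero \<open>rank A \<noteq> 0\<close>] by (simp add: Ah r)
  \<comment> \<open>The claim with denominators cleared; multiplying by \<open>?d\<^sup>2\<close>
    rather than cancelling it also covers L = I.\<close>
  then have "?d\<^sup>2 * (?K * ?d\<^sup>2 + ?t\<^sup>2) \<le> ?d\<^sup>2 * (?K * ?d\<^sup>2 + ?K * ?s\<^sup>2)"
    by (intro mult_left_mono add_left_mono) auto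
  then have "?d\<^sup>2 * (?K * ?d\<^sup>2 + ?t\<^sup>2) \<le> ?K * ?d\<^sup>2 * (?d\<^sup>2 + ?s\<^sup>2)"
    by (simp add: algebra_simps)
  moreover have "0 < ?d\<^sup>2 + ?s\<^sup>2"
    using s by (simp add: add_nonneg_pos)
  moreover have "0 < ?K * ?d\<^sup>2 + ?t\<^sup>2"
    using K t by (intro add_nonneg_pos) auto
  ultimately show "?d\<^sup>2 / (?d\<^sup>2 + ?s\<^sup>2) \<le> ?K * ?d\<^sup>2 / (?K * ?d\<^sup>2 + ?t\<^sup>2)"
    by (simp add: divide_le_eq le_divide_eq mult.commute)
qed
end
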